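(* Let $G=(V,E)$ be a uniformly colored directed graph with coloring function $c:E\to S$, and let $\mathfrak{n}$ be the corresponding uniform Lie algebra, with basis $V\cup S$. Let $\phi$ be a color-permuting automorphism of $G$, with permutation $\sigma$ of $S$, and let $\hat\phi:\mathfrak{n}\to\mathfrak{n}$ be the linear map with $\hat\phi(v)=\phi(v)$ for $v\in V$ and $\hat\phi(z)=\sigma(z)$ for $z\in S$. Then $\hat\phi$ is an automorphism of the Lie algebra $\mathfrak{n}$. Furthermore, the map $\phi\mapsto\hat\phi$ from the group of color-permuting automorphisms of $G$ to the automorphism group of $\mathfrak{n}$ is injective.
   Context: Graphs have no loops or multiple edges. A uniform edge coloring of type $(p,q,r)$ ($p,q,r$ positive integers) with degree $s\ge 1$ on an undirected $s$-regular graph $(V,E)$ with $q$ vertices is a surjective map $c:E\to S$, $|S|=p$, such that adjacent edges have different colors (the coloring is proper) and $|c^{-1}(\{k\})|=r$ for every $k\in S$. A uniformly colored directed graph is an undirected graph with a uniform edge coloring, endowed with an orientation of its edges (so $(v,w)$ and $(w,v)$ are never both edges). A color-permuting automorphism of $G$ is an automorphism $\phi$ of the underlying directed graph for which there is a permutation $\sigma$ of $S$ with $c(\phi(v),\phi(w))=\sigma(c(v,w))$ for all $(v,w)\in E$. The Lie algebra $\mathfrak{n}$ corresponding to a uniformly colored directed graph $G$ is the real vector space with basis $V\cup S$ (disjoint union) and bilinear bracket determined by: $[v,w]=c(v,w)$ if $(v,w)\in E$; $[v,w]=-c(w,v)$ if $(w,v)\in E$; $[v,w]=0$ for other $v,w\in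 V$; and $[v,z]=[z,v]=[z,z']=0$ for $v\in V$, $z,z'\in S$. *)

theory Defs
  imports "HOL-Analysis.Analysis" "HOL-Algebra.Group"
begin

text \<open>
  The vertex set \<open>V\<close> and the colour set \<open>S\<close> are the universes of two finite types \<open>'v\<close> and \<open>'s\<close>.
  An undirected graph on \<open>'v\<close> is given by its set \<open>U\<close> of two-element edges.
\<close>

locale uniform_edge_coloring =
  fixes p q r s :: nat
    and U :: "'v::finite set set"
    and c :: "'v set \<Rightarrow> 's::finite"
  assumes parameters_pos: "0 < p" "0 < q" "0 < r"
    and degree_pos: "1 \<le> s"
    and simple: "\<And>e. e \<in> U \<Longrightarrow> card e = 2"
    and card_vertices: "CARD('v) = q"
    and card_colors: "CARD('s) = p"
    and regular: "\<And>v. card {e \<in> U. v \<in> e} = s"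
    and surjective: "c ` U = UNIV"
    and proper: "\<And>e f. \<lbrakk>e \<in> U; f \<in> U; e \<noteq> f; e \<inter> f \<noteq> {}\<rbrakk> \<Longrightarrow> c e \<noteq> c f"
    and uniform: "\<And>k. card {e \<in> U. c e = k} = r"

definition underlying_edges :: "('v \<times> 'v) set \<Rightarrow> 'v set set" where
  "underlying_edges E = (\<lambda>(v, w). {v, w}) ` E"

text \<open>
  The colouring lives on undirected edges, so the colour \<open>c(v,w)\<close> of a directed edge
  is \<open>c {v, w}\<close>; the values of \<open>c\<close> on sets that are not edges are irrelevant.
\<close>

locale uniformly_colored_digraph =
  uniform_edge_coloring p q r s "underlying_edges E" c
  for p q r s :: nat
    and E :: "('v::finite \<times> 'v) set"
    and c :: "'v set \<Rightarrow> 's::finite" +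
  assumes oriented: "asym E"

definition digraph_automorphism :: "('v \<times> 'v) set \<Rightarrow> ('v \<Rightarrow> 'v) \<Rightarrow> bool" where
  "digraph_automorphism E \<phi> \<longleftrightarrow>
     bij \<phi> \<and> (\<forall>v w. (v, w) \<in> E \<longleftrightarrow> (\<phi> v, \<phi> w) \<in> E)"

definition permutes_colors ::
  "('v \<times> 'v) set \<Rightarrow> ('v set \<Rightarrow> 's) \<Rightarrow> ('v \<Rightarrow> 'v) \<Rightarrow> ('s \<Rightarrow> 's) \<Rightarrow> bool" where
  "permutes_colors E c \<phi> \<sigma> \<longleftrightarrow>
     bij \<sigma> \<and> (\<forall>v w. (v, w) \<in> E \<longrightarrow> c {\<phi> v, \<phi> w} = \<sigma> (c {v, w}))"

definition color_permuting_automorphism ::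
  "('v \<times> 'v) set \<Rightarrow> ('v set \<Rightarrow> 's) \<Rightarrow> ('v \<Rightarrow> 'v) \<Rightarrow> bool" where
  "color_permuting_automorphism E c \<phi> \<longleftrightarrow>
     digraph_automorphism E \<phi> \<and> (\<exists>\<sigma>. permutes_colors E c \<phi> \<sigma>)"

definition color_permuting_group ::
  "('v \<times> 'v) set \<Rightarrow> ('v set \<Rightarrow> 's) \<Rightarrow> ('v \<Rightarrow> 'v) monoid" where
  "color_permuting_group E c =
     \<lparr>carrier = {\<phi>. color_permuting_automorphism E c \<phi>}, mult = (\<circ>), one = id\<rparr>"

text \<open>The permutation is unique because \<open>c\<close> is surjective; see \<open>color_permutation_eq\<close> below.\<close>

definition color_permutation ::
  "('v \<times> 'v) set \<Rightarrow> ('v set \<Rightarrow> 's) \<Rightarrow> ('v \<Rightarrow> 'v) \<Rightarrow> ('s \<Rightarrow> 's)" where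
  "color_permutation E c \<phi> = (THE \<sigma>. permutes_colors E c \<phi> \<sigma>)"

lemma (in uniformly_colored_digraph) color_permutation_eq:
  assumes "permutes_colors E c \<phi> \<sigma>"
  shows "color_permutation E c \<phi> = \<sigma>"
  unfolding color_permutation_def
proof (rule the_equality)
  show "permutes_colors E c \<phi> \<sigma>" by fact
next
  fix \<tau> assume \<tau>: "permutes_colors E c \<phi> \<tau>"
  show "\<tau> = \<sigma>"
  proof
    fix k
    have "k \<in> c ` underlying_edges E" using surjective by simp
    then obtain v w where "(v, w) \<in> E" "k = c {v, w}"
      by (auto simp: underlying_edges_def)
    then show "\<tau> k = \<sigma> k"
      using \<tau> assms by (metis permutes_colors_def)
  qed
qed

lemma group_color_permuting_group: "group (color_permuting_group E c)"
proof (rule groupI)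
  fix \<phi> \<psi>
  assume "\<phi> \<in> carrier (color_permuting_group E c)" "\<psi> \<in> carrier (color_permuting_group E c)"
  then obtain \<sigma> \<tau> where
    "digraph_automorphism E \<phi>" "permutes_colors E c \<phi> \<sigma>"
    "digraph_automorphism E \<psi>" "permutes_colors E c \<psi> \<tau>"
    by (auto simp: color_permuting_group_def color_permuting_automorphism_def)
  then have "digraph_automorphism E (\<phi> \<circ> \<psi>)" "permutes_colors E c (\<phi> \<circ> \<psi>) (\<sigma> \<circ> \<tau>)"
    by (auto simp: digraph_automorphism_def permutes_colors_def intro: bij_comp)
  then show "\<phi> \<otimes>\<^bsub>color_permuting_group E c\<^esub> \<psi> \<in> carrier (color_permuting_group E c)"
    by (auto simp: color_permuting_group_def color_permuting_automorphism_def)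
next
  have "permutes_colors E c id id" by (simp add: permutes_colors_def)
  then show "\<one>\<^bsub>color_permuting_group E c\<^esub> \<in> carrier (color_permuting_group E c)"
    by (auto simp: color_permuting_group_def color_permuting_automorphism_def
        digraph_automorphism_def)
next
  fix \<phi> assume "\<phi> \<in> carrier (color_permuting_group E c)"
  then obtain \<sigma> where \<phi>: "digraph_automorphism E \<phi>" and \<sigma>: "permutes_colors E c \<phi> \<sigma>"
    by (auto simp: color_permuting_group_def color_permuting_automorphism_def)
  from \<phi> have b: "bij \<phi>" and e: "\<And>v w. (v, w) \<in> E \<longleftrightarrow> (\<phi> v, \<phi> w) \<in> E"
    by (auto simp: digraph_automorphism_def)
  have i: "\<phi> (inv_into UNIV \<phi> v) = v" for v using b by (simp add: bij_is_surj surj_f_inv_f)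
  have "digraph_automorphism E (inv_into UNIV \<phi>)"
    unfolding digraph_automorphism_def
  proof (intro conjI allI)
    show "bij (inv_into UNIV \<phi>)" using b by (rule bij_imp_bij_inv)
    show "(v, w) \<in> E \<longleftrightarrow> (inv_into UNIV \<phi> v, inv_into UNIV \<phi> w) \<in> E" for v w
      using e[of "inv_into UNIV \<phi> v" "inv_into UNIV \<phi> w"] by (simp add: i)
  qed
  moreover have "permutes_colors E c (inv_into UNIV \<phi>) (inv_into UNIV \<sigma>)"
    unfolding permutes_colors_def
  proof (intro conjI allI impI)
    show "bij (inv_into UNIV \<sigma>)" using \<sigma> by (simp add: permutes_colors_def bij_imp_bij_inv)
    fix v w assume "(v, w) \<in> E"
    then have "(inv_into UNIV \<phi> v, inv_into UNIV \<phi> w) \<in> E"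
      using e[of "inv_into UNIV \<phi> v" "inv_into UNIV \<phi> w"] by (simp add: i)
    then have "c {v, w} = \<sigma> (c {inv_into UNIV \<phi> v, inv_into UNIV \<phi> w})"
      using \<sigma> i by (metis permutes_colors_def)
    then show "c {inv_into UNIV \<phi> v, inv_into UNIV \<phi> w} = inv_into UNIV \<sigma> (c {v, w})"
      using \<sigma> by (simp add: permutes_colors_def bij_is_inj)
  qed
  moreover have "inv_into UNIV \<phi> \<circ> \<phi> = id" using b by (simp add: bij_is_inj)
  ultimately show "\<exists>\<psi> \<in> carrier (color_permuting_group E c).
      \<psi> \<otimes>\<^bsub>color_permuting_group E c\<^esub> \<phi> = \<one>\<^bsub>color_permuting_group E c\<^esub>"
    by (auto simp: color_permuting_group_def color_permuting_automorphism_def)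
qed (auto simp: color_permuting_group_def)

locale lie_algebra =
  fixes bracket :: "'a::real_vector \<Rightarrow> 'a \<Rightarrow> 'a"
  assumes bilinear: "bilinear bracket"
    and alternating: "bracket x x = 0"
    and Jacobi: "bracket x (bracket y z) + bracket y (bracket z x) + bracket z (bracket x y) = 0"

definition lie_automorphism ::
  "('a::real_vector \<Rightarrow> 'a \<Rightarrow> 'a) \<Rightarrow> ('a \<Rightarrow> 'a) \<Rightarrow> bool" where
  "lie_automorphism bracket f \<longleftrightarrow>
     linear f \<and> bij f \<and> (\<forall>x y. f (bracket x y) = bracket (f x) (f y))"

definition lie_automorphism_group ::
  "('a::real_vector \<Rightarrow> 'a \<Rightarrow> 'a) \<Rightarrow> ('a \<Rightarrow> 'a) monoid" where
  "lie_automorphism_group bracket =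
     \<lparr>carrier = {f. lie_automorphism bracket f}, mult = (\<circ>), one = id\<rparr>"

lemma group_lie_automorphism_group: "group (lie_automorphism_group bracket)"
proof (rule groupI)
  fix f assume "f \<in> carrier (lie_automorphism_group bracket)"
  then have l: "linear f" and b: "bij f" and h: "\<And>x y. f (bracket x y) = bracket (f x) (f y)"
    by (auto simp: lie_automorphism_group_def lie_automorphism_def)
  have i: "f (inv_into UNIV f x) = x" for x using b by (simp add: bij_is_surj surj_f_inv_f)
  have j: "inv_into UNIV f (f x) = x" for x using b by (simp add: bij_is_inj)
  have "linear (inv_into UNIV f)"
  proof (rule linearI)
    show "inv_into UNIV f (x + y) = inv_into UNIV f x + inv_into UNIV f y" for x y
      using j[of "inv_into UNIV f x + inv_into UNIV f y"] by (simp add: linear_add[OF l] i)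
    show "inv_into UNIV f (r *\<^sub>R x) = r *\<^sub>R inv_into UNIV f x" for r x
      using j[of "r *\<^sub>R inv_into UNIV f x"] by (simp add: linear_cmul[OF l] i)
  qed
  moreover have "inv_into UNIV f (bracket x y) = bracket (inv_into UNIV f x) (inv_into UNIV f y)" for x y
    using j[of "bracket (inv_into UNIV f x) (inv_into UNIV f y)"] by (simp add: h i)
  ultimately have "lie_automorphism bracket (inv_into UNIV f)"
    using b by (simp add: lie_automorphism_def bij_imp_bij_inv)
  moreover have "inv_into UNIV f \<circ> f = id" using j by auto
  ultimately show "\<exists>g \<in> carrier (lie_automorphism_group bracket).
      g \<otimes>\<^bsub>lie_automorphism_group bracket\<^esub> f = \<one>\<^bsub>lie_automorphism_group bracket\<^esub>"
    by (auto simp: lie_automorphism_group_def)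
qed (auto simp: lie_automorphism_group_def lie_automorphism_def
    intro: bij_comp linear_compose linear_id)

text \<open>
  The space \<open>\<nn>\<close> with basis \<open>V \<union> S\<close> (disjoint union) is \<open>real ^ ('v + 's)\<close>, with the vertex \<open>v\<close>
  as the standard basis vector at \<open>Inl v\<close> and the colour \<open>z\<close> as the one at \<open>Inr z\<close>.
\<close>

abbreviation basis_vec :: "'i::finite \<Rightarrow> real ^ 'i" where
  "basis_vec a \<equiv> axis a 1"

fun basis_bracket ::
  "('v::finite \<times> 'v) set \<Rightarrow> ('v set \<Rightarrow> 's::finite) \<Rightarrow> 'v + 's \<Rightarrow> 'v + 's \<Rightarrow> real ^ ('v + 's)" where
  "basis_bracket E c (Inl v) (Inl w) =
     (if (v, w) \<in> E then basis_vec (Inr (c {v, w}))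
      else if (w, v) \<in> E then - basis_vec (Inr (c {w, v}))
      else 0)"
| "basis_bracket E c (Inl v) (Inr z) = 0"
| "basis_bracket E c (Inr z) (Inl v) = 0"
| "basis_bracket E c (Inr z) (Inr z') = 0"

definition uniform_bracket ::
  "('v::finite \<times> 'v) set \<Rightarrow> ('v set \<Rightarrow> 's::finite) \<Rightarrow>
   real ^ ('v + 's) \<Rightarrow> real ^ ('v + 's) \<Rightarrow> real ^ ('v + 's)" where
  "uniform_bracket E c x y =
     (\<Sum>a\<in>UNIV. \<Sum>b\<in>UNIV. (x $ a * y $ b) *\<^sub>R basis_bracket E c a b)"

definition induced_map ::
  "('v::finite \<Rightarrow> 'v) \<Rightarrow> ('s::finite \<Rightarrow> 's) \<Rightarrow> real ^ ('v + 's) \<Rightarrow> real ^ ('v + 's)" where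
  "induced_map \<phi> \<sigma> x = (\<Sum>a\<in>UNIV. x $ a *\<^sub>R basis_vec (map_sum \<phi> \<sigma> a))"

lemma uniform_bracket_basis:
  "uniform_bracket E c (basis_vec a) (basis_vec b) = basis_bracket E c a b"
proof -
  have "uniform_bracket E c (basis_vec a) (basis_vec b) =
      (\<Sum>a'\<in>UNIV. if a' = a then (\<Sum>b'\<in>UNIV. if b' = b then basis_bracket E c a' b' else 0) else 0)"
    unfolding uniform_bracket_def
    by (intro sum.cong refl) (auto simp: axis_def if_distrib[of "\<lambda>t. t *\<^sub>R _"] cong: if_cong)
  then show ?thesis by simp
qed

lemma linear_induced_map: "linear (induced_map \<phi> \<sigma>)"
  unfolding induced_map_def
  by (intro linearI) (simp_all add: algebra_simps sum.distrib scaleR_sum_right)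

lemma induced_map_basis: "induced_map \<phi> \<sigma> (basis_vec a) = basis_vec (map_sum \<phi> \<sigma> a)"
proof -
  have "induced_map \<phi> \<sigma> (basis_vec a) =
      (\<Sum>b\<in>UNIV. if b = a then basis_vec (map_sum \<phi> \<sigma> b) else 0)"
    unfolding induced_map_def by (intro sum.cong refl) (auto simp: axis_def)
  then show ?thesis by simp
qed

lemma bilinear_uniform_bracket: "bilinear (uniform_bracket E c)"
  unfolding bilinear_def uniform_bracket_def
  by (intro conjI allI linearI) (simp_all add: algebra_simps sum.distrib scaleR_sum_right)

lemma lie_algebra_uniform_bracket:
  assumes "asym E"
  shows "lie_algebra (uniform_bracket E c)"
proof
  show "bilinear (uniform_bracket E c)" by (rule bilinear_uniform_bracket)
  have anti: "basis_bracket E c a b = - basis_bracket E c b a" for a b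
    using assms by (cases a; cases b) (auto dest: asymD)
  have "uniform_bracket E c x x = - uniform_bracket E c x x" for x
  proof -
    have "uniform_bracket E c x x =
        (\<Sum>b\<in>UNIV. \<Sum>a\<in>UNIV. (x $ a * x $ b) *\<^sub>R basis_bracket E c a b)"
      unfolding uniform_bracket_def by (rule sum.swap)
    also have "\<dots> = (\<Sum>b\<in>UNIV. \<Sum>a\<in>UNIV. - ((x $ b * x $ a) *\<^sub>R basis_bracket E c b a))"
      by (intro sum.cong refl) (subst anti, simp add: mult.commute)
    also have "\<dots> = - uniform_bracket E c x x"
      by (simp add: uniform_bracket_def sum_negf)
    finally show ?thesis .
  qed
  then have "uniform_bracket E c x x + uniform_bracket E c x x = 0" for x
    by (simp only: eq_neg_iff_add_eq_0)
  then have "2 *\<^sub>R uniform_bracket E c x x = 0" for x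
    by (simp only: scaleR_2)
  then show "uniform_bracket E c x x = 0" for x
    by simp
  have vertex_zero: "uniform_bracket E c y z $ Inl v = 0" for y z v
  proof -
    have "basis_bracket E c a b $ Inl v = 0" for a b
      by (cases a; cases b) (auto simp: axis_def)
    then show ?thesis by (simp add: uniform_bracket_def)
  qed
  have "uniform_bracket E c x (uniform_bracket E c y z) = 0" for x y z
  proof -
    have "(x $ a * uniform_bracket E c y z $ b) *\<^sub>R basis_bracket E c a b = 0" for a b
      by (cases a; cases b) (auto simp: vertex_zero)
    then show ?thesis
      by (subst uniform_bracket_def) (intro sum.neutral ballI)
  qed
  then show "uniform_bracket E c x (uniform_bracket E c y z) +
      uniform_bracket E c y (uniform_bracket E c z x) +
      uniform_bracket E c z (uniform_bracket E c x y) = 0" for x y z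
    by simp
qed

end

theory Submission
  imports Defs
begin

text \<open>Both the bracket and the induced map are determined by their values on the basis of
  vertices and colors. There \<open>\<phi>\<close> preserves edges, non-edges and orientation while
  \<open>\<sigma>\<close> carries the colors along, so brackets are respected
  (\<open>induced_map_basis_bracket\<close>); bilinearity extends this to all vectors
  (\<open>induced_map_uniform_bracket\<close>). Bijectivity follows from functoriality
  (\<open>induced_map_comp\<close>). The images of the vertices recover \<open>\<phi>\<close>, which
  gives injectivity (\<open>induced_map_eq_iff\<close>).\<close>

lemma induced_map_id: "induced_map id id = id"
  by (rule linear_eq_stdbasis)
    (auto simp: linear_induced_map linear_id Basis_vec_def induced_map_basis map_sum.id)

lemma induced_map_comp:
  "induced_map \<phi> \<sigma> \<circ> induced_map \<psi> \<tau> = induced_map (\<phi> \<circ> \<psi>) (\<sigma> \<circ> \<tau>)"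
  by (rule linear_eq_stdbasis)
    (auto simp: linear_compose linear_induced_map Basis_vec_def induced_map_basis
      sum.map_comp)

text \<open>By functoriality, the map induced by the inverse permutations is a two-sided
  inverse.\<close>

lemma bij_induced_map:
  assumes "bij \<phi>" "bij \<sigma>"
  shows "bij (induced_map \<phi> \<sigma>)"
proof (rule o_bij)
  show "induced_map (inv_into UNIV \<phi>) (inv_into UNIV \<sigma>) \<circ> induced_map \<phi> \<sigma> = id"
    using assms by (simp add: induced_map_comp induced_map_id bij_is_inj)
  show "induced_map \<phi> \<sigma> \<circ> induced_map (inv_into UNIV \<phi>) (inv_into UNIV \<sigma>) = id"
    using assms by (simp add: induced_map_comp induced_map_id bij_is_surj surj_iff[THEN iffD1])
qed

lemma induced_map_eq_iff: "induced_map \<phi> \<sigma> = induced_map \<psi> \<tau> \<longleftrightarrow> \<phi> = \<psi> \<and> \<sigma> = \<tau>"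
proof
  assume eq: "induced_map \<phi> \<sigma> = induced_map \<psi> \<tau>"
  have "map_sum \<phi> \<sigma> a = map_sum \<psi> \<tau> a" for a
    using fun_cong[OF eq, of "basis_vec a"] by (simp add: induced_map_basis axis_eq_axis)
  \<comment> \<open>Vertices determine the first component, colors the second.\<close>
  from this[of "Inl _"] this[of "Inr _"] show "\<phi> = \<psi> \<and> \<sigma> = \<tau>"
    by auto
qed simp

text \<open>The equivalence in \<open>digraph_automorphism\<close> matters: non-edges go to
  non-edges, so zero brackets stay zero, and a reversed edge stays reversed, so the sign survives.
  Pairs involving a color give zero on both sides because \<open>map_sum\<close> keeps vertices and
  colors apart.\<close>

lemma induced_map_basis_bracket:
  assumes "digraph_automorphism E \<phi>" "permutes_colors E c \<phi> \<sigma>"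
  shows "induced_map \<phi> \<sigma> (basis_bracket E c a b) =
    basis_bracket E c (map_sum \<phi> \<sigma> a) (map_sum \<phi> \<sigma> b)"
  using assms
  by (cases a; cases b)
    (auto simp: digraph_automorphism_def permutes_colors_def induced_map_basis
      linear_0[OF linear_induced_map] linear_neg[OF linear_induced_map])

lemma induced_map_uniform_bracket:
  assumes "digraph_automorphism E \<phi>" "permutes_colors E c \<phi> \<sigma>"
  shows "induced_map \<phi> \<sigma> (uniform_bracket E c x y) =
    uniform_bracket E c (induced_map \<phi> \<sigma> x) (induced_map \<phi> \<sigma> y)"
proof -
  let ?f = "induced_map \<phi> \<sigma>" and ?B = "uniform_bracket E c"
  have l: "linear (?B u)" "linear (\<lambda>v. ?B v u)" for u
    using bilinear_uniform_bracket[of E c] by (auto simp: bilinear_def)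
  note comp = linear_compose[unfolded o_def]
  \<comment> \<open>Both sides are bilinear in \<open>x\<close> and \<open>y\<close>, so it suffices
    to compare them on pairs of standard basis vectors.\<close>
  have "(\<lambda>x y. ?f (?B x y)) = (\<lambda>x y. ?B (?f x) (?f y))"
  proof (rule bilinear_eq_stdbasis)
    show "bilinear (\<lambda>x y. ?f (?B x y))"
      unfolding bilinear_def by (intro conjI allI comp[OF _ linear_induced_map] l)
    show "bilinear (\<lambda>x y. ?B (?f x) (?f y))"
      unfolding bilinear_def by (intro conjI allI comp[OF linear_induced_map] l)
    show "?f (?B i j) = ?B (?f i) (?f j)" if "i \<in> Basis" "j \<in> Basis" for i j
      using that
      by (auto simp: Basis_vec_def uniform_bracket_basis induced_map_basis
          induced_map_basis_bracket[OF assms])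
  qed
  then show ?thesis by meson
qed

lemma lie_automorphism_induced_map:
  assumes "digraph_automorphism E \<phi>" "permutes_colors E c \<phi> \<sigma>"
  shows "lie_automorphism (uniform_bracket E c) (induced_map \<phi> \<sigma>)"
  using assms linear_induced_map bij_induced_map induced_map_uniform_bracket[OF assms]
  unfolding lie_automorphism_def digraph_automorphism_def permutes_colors_def by blast

theorem proposition4p16:
  fixes p q r s :: nat
    and E :: "('v::finite \<times> 'v) set"
    and c :: "'v set \<Rightarrow> 's::finite"
  assumes "uniformly_colored_digraph p q r s E c"
  shows "(\<forall>\<phi> \<sigma>. digraph_automorphism E \<phi> \<and> permutes_colors E c \<phi> \<sigma> \<longrightarrow>
            lie_automorphism (uniform_bracket E c) (induced_map \<phi> \<sigma>)) \<and>
         (\<lambda>\<phi>. induced_map \<phi> (color_permutation E c \<phi>))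
            \<in> carrier (color_permuting_group E c) \<rightarrow>
               carrier (lie_automorphism_group (uniform_bracket E c)) \<and>
         inj_on (\<lambda>\<phi>. induced_map \<phi> (color_permutation E c \<phi>))
            (carrier (color_permuting_group E c))"
proof -
  interpret uniformly_colored_digraph p q r s E c by fact
  show ?thesis
    \<comment> \<open>Membership in the group supplies some \<open>\<sigma>\<close>; since
      \<open>c\<close> is surjective, \<open>color_permutation_eq\<close> identifies the chosen
      permutation with it, so the first claim applies.\<close>
    by (auto simp: lie_automorphism_induced_map color_permuting_group_def
        lie_automorphism_group_def color_permuting_automorphism_def color_permutation_eq
        induced_map_eq_iff intro!: inj_onI)
qed

end
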